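(* Let $K$ be a field, let $(\mathfrak{L},\delta)$ be a Leibniz coalgebra over $K$ and let $\omega\in(\mathfrak{L}\otimes\mathfrak{L})^*$ be a symmetric bilinear form. If $(\mathfrak{L},\delta,\omega,[,]_\omega)$ is a dual triangular Leibniz bialgebra, where $$[x,y]_\omega=-\omega(x,y_{(1)})y_{(2)}+\omega(y,x_{(1)})x_{(2)}+x_{(1)}\omega(y,x_{(2)}),\qquad x,y\in\mathfrak{L},$$ then $(\mathfrak{L},[,]_\omega,\omega)$ is a symplectic Leibniz algebra.
   Context: All vector spaces, tensor products and linear maps are over a fixed field $K$; Sweedler notation $\delta(x)=x_{(1)}\otimes x_{(2)}$ is used with summation understood. A (left) Leibniz algebra $(\mathfrak{L},[,])$: bilinear bracket with $[x,[y,z]]=[[x,y],z]+[y,[x,z]]$ for all $x,y,z$. A Leibniz coalgebra $(\mathfrak{L},\delta)$: linear $\delta:\mathfrak{L}\to\mathfrak{L}\otimes\mathfrak{L}$ with $x_{(1)}\otimes x_{(2)(1)}\otimes x_{(2)(2)}=x_{(1)(1)}\otimes x_{(1)(2)}\otimes x_{(2)}+x_{(2)(1)}\otimes x_{(1)}\otimes x_{(2)(2)}$ for all $x$. A Leibniz bialgebra $(\mathfrak{L},[,],\delta)$: a Leibniz algebra and a Leibniz coalgebra such that for all $x,y$: $0=x_{(2)}\otimes [x_{(1)}, y]-[y_{(1)}, x]\otimes y_{(2)}$ and $\delta([x,y])=x_{(1)}\otimes [x_{(2)}, y]-[y, x_{(1)}]\otimes x_{(2)}-[x_{(1)}, y]\otimes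 x_{(2)}+x_{(2)}\otimes [x_{(1)}, y]-[y, x_{(2)}]\otimes x_{(1)}-[x_{(2)}, y]\otimes x_{(1)}+[x, y_{(1)}]\otimes y_{(2)}+y_{(1)}\otimes [x, y_{(2)}]$. Dual triangular: $(\mathfrak{L},\delta,\omega,[,]_\omega)$ is a dual triangular Leibniz bialgebra if $(\mathfrak{L},\delta)$ is a Leibniz coalgebra and the bilinear form $\omega$ is symmetric ($\omega(x,y)=\omega(y,x)$) and solves the co-classical Leibniz Yang-Baxter equation in $(\mathfrak{L},\delta)$: for all $x,y,z$, $$\omega(x,y_{(1)})\omega(y_{(2)},z)+\omega(x,z_{(1)})\omega(y,z_{(2)})=\omega(y,x_{(1)})\omega(x_{(2)},z)+\omega(x_{(1)},z)\omega(y,x_{(2)})$$ (then $(\mathfrak{L},[,]_\omega,\delta)$ is a Leibniz bialgebra). Symplectic Leibniz algebra $(\mathfrak{L},[,],\omega)$: a Leibniz algebra with a symmetric bilinear form $\omega$ satisfying $\omega([x,y],z)+\omega([x,z],y)=\omega([y,z],x)+\omega([z,y],x)$ for all $x,y,z$. *)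

theory Defs
  imports Complex_Main "HOL-Library.Poly_Mapping"
begin

section \<open>Formal linear combinations\<close>

definition free_scale :: "'k::field \<Rightarrow> ('b \<Rightarrow>\<^sub>0 'k) \<Rightarrow> ('b \<Rightarrow>\<^sub>0 'k)" where
  "free_scale c p = Poly_Mapping.map ((*) c) p"

lemma lookup_free_scale [simp]:
  "Poly_Mapping.lookup (free_scale c p) k = c * Poly_Mapping.lookup p k"
  unfolding free_scale_def by transfer (simp add: when_def)

interpretation free: vector_space "free_scale :: 'k::field \<Rightarrow> ('b \<Rightarrow>\<^sub>0 'k) \<Rightarrow> _"
  by unfold_locales
    (auto intro!: poly_mapping_eqI simp: lookup_add algebra_simps)

text \<open>The linear extension to formal linear combinations of a map \<open>f\<close> on generators, with values
  in the vector space with scalar multiplication \<open>s\<close>.\<close>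

definition free_eval :: "('k::field \<Rightarrow> 'w::ab_group_add \<Rightarrow> 'w) \<Rightarrow> ('b \<Rightarrow> 'w) \<Rightarrow> ('b \<Rightarrow>\<^sub>0 'k) \<Rightarrow> 'w" where
  "free_eval s f p = (\<Sum>k\<in>Poly_Mapping.keys p. s (Poly_Mapping.lookup p k) (f k))"


section \<open>Tensor products\<close>

text \<open>The tensor product of a vector space with itself is the quotient of the space of formal
  linear combinations of pairs by the span of the bilinearity relations, and likewise for the
  threefold product. Since the relations depend on the scalar multiplication, the quotient is
  a set of cosets and not a type.\<close>

definition bilinear_relations ::
    "('k::field \<Rightarrow> 'v::ab_group_add \<Rightarrow> 'v) \<Rightarrow> ('v \<times> 'v \<Rightarrow>\<^sub>0 'k) set" where
  "bilinear_relations s =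
    {Poly_Mapping.single (s a x + s b x', y) 1
       - Poly_Mapping.single (x, y) a - Poly_Mapping.single (x', y) b | a b x x' y. True} \<union>
    {Poly_Mapping.single (x, s a y + s b y') 1
       - Poly_Mapping.single (x, y) a - Poly_Mapping.single (x, y') b | a b x y y'. True}"

definition trilinear_relations ::
    "('k::field \<Rightarrow> 'v::ab_group_add \<Rightarrow> 'v) \<Rightarrow> ('v \<times> 'v \<times> 'v \<Rightarrow>\<^sub>0 'k) set" where
  "trilinear_relations s =
    {Poly_Mapping.single (s a x + s b x', y, z) 1
       - Poly_Mapping.single (x, y, z) a - Poly_Mapping.single (x', y, z) b | a b x x' y z. True} \<union>
    {Poly_Mapping.single (x, s a y + s b y', z) 1
       - Poly_Mapping.single (x, y, z) a - Poly_Mapping.single (x, y', z) b | a b x y y' z. True} \<union>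
    {Poly_Mapping.single (x, y, s a z + s b z') 1
       - Poly_Mapping.single (x, y, z) a - Poly_Mapping.single (x, y, z') b | a b x y z z'. True}"

definition cong_rel :: "('b \<Rightarrow>\<^sub>0 'k::field) set \<Rightarrow> (('b \<Rightarrow>\<^sub>0 'k) \<times> ('b \<Rightarrow>\<^sub>0 'k)) set" where
  "cong_rel R = {(p, q). p - q \<in> free.span R}"

definition tensor_class :: "('b \<Rightarrow>\<^sub>0 'k::field) set \<Rightarrow> ('b \<Rightarrow>\<^sub>0 'k) \<Rightarrow> ('b \<Rightarrow>\<^sub>0 'k) set" where
  "tensor_class R p = cong_rel R `` {p}"

definition tensor_space :: "('b \<Rightarrow>\<^sub>0 'k::field) set \<Rightarrow> ('b \<Rightarrow>\<^sub>0 'k) set set" where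
  "tensor_space R = UNIV // cong_rel R"

definition tensor_rep :: "('b \<Rightarrow>\<^sub>0 'k::field) set \<Rightarrow> ('b \<Rightarrow>\<^sub>0 'k)" where
  "tensor_rep t = (SOME p. p \<in> t)"

lemma equiv_cong_rel: "equiv UNIV (cong_rel R)"
proof (rule equivI)
  show "refl (cong_rel R)"
    by (auto simp: cong_rel_def refl_on_def free.span_zero)
  show "sym (cong_rel R)"
    unfolding sym_def cong_rel_def
    by (auto dest: free.span_neg)
  show "trans (cong_rel R)"
    unfolding trans_def cong_rel_def
    by (auto, metis (no_types, lifting) diff_add_cancel diff_diff_eq2 free.span_add)
qed auto

lemma tensor_class_eq_iff: "tensor_class R p = tensor_class R q \<longleftrightarrow> p - q \<in> free.span R"
  unfolding tensor_class_def
  using eq_equiv_class_iff[OF equiv_cong_rel, of p q R] by (auto simp: cong_rel_def)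

lemma tensor_rep_class: "tensor_rep (tensor_class R p) - p \<in> free.span R"
proof -
  have "p \<in> tensor_class R p"
    by (simp add: tensor_class_def cong_rel_def free.span_zero)
  then have "tensor_rep (tensor_class R p) \<in> tensor_class R p"
    unfolding tensor_rep_def by (rule someI)
  then have "p - tensor_rep (tensor_class R p) \<in> free.span R"
    by (simp add: tensor_class_def cong_rel_def)
  then show ?thesis
    using free.span_neg by fastforce
qed

lemma tensor_class_rep:
  assumes "t \<in> tensor_space R"
  shows "tensor_class R (tensor_rep t) = t"
proof -
  obtain p where t: "t = tensor_class R p"
    using assms unfolding tensor_space_def tensor_class_def by (auto elim: quotientE)
  show ?thesis
    unfolding t tensor_class_eq_iff by (rule tensor_rep_class)
qed

definition tensor_add :: "('b \<Rightarrow>\<^sub>0 'k::field) set \<Rightarrow> ('b \<Rightarrow>\<^sub>0 'k) set \<Rightarrow> ('b \<Rightarrow>\<^sub>0 'k) set \<Rightarrow> ('b \<Rightarrow>\<^sub>0 'k) set" where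
  "tensor_add R t u = tensor_class R (tensor_rep t + tensor_rep u)"

definition tensor_scale :: "('b \<Rightarrow>\<^sub>0 'k::field) set \<Rightarrow> 'k \<Rightarrow> ('b \<Rightarrow>\<^sub>0 'k) set \<Rightarrow> ('b \<Rightarrow>\<^sub>0 'k) set" where
  "tensor_scale R c t = tensor_class R (free_scale c (tensor_rep t))"

lemma tensor_add_class:
  "tensor_add R (tensor_class R p) (tensor_class R q) = tensor_class R (p + q)"
  unfolding tensor_add_def tensor_class_eq_iff
  using free.span_add[OF tensor_rep_class[of R p] tensor_rep_class[of R q]]
  by (simp add: algebra_simps)

lemma tensor_scale_class:
  "tensor_scale R c (tensor_class R p) = tensor_class R (free_scale c p)"
  unfolding tensor_scale_def tensor_class_eq_iff
  using free.span_scale[OF tensor_rep_class[of R p], of c]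
  by (simp add: free.scale_right_diff_distrib)

text \<open>Sweedler notation: for \<open>t = t\<^sub>1 \<otimes> t\<^sub>2\<close> (summation understood),
  \<open>sweedler s t (\<lambda>t\<^sub>1 t\<^sub>2. f t\<^sub>1 t\<^sub>2)\<close> is the sum of the \<open>f t\<^sub>1 t\<^sub>2\<close> in the vector space with scalar
  multiplication \<open>s\<close>. For bilinear \<open>f\<close> it does not depend on the representative chosen
  (\<open>sweedler_class\<close> below).\<close>

definition sweedler ::
    "('k::field \<Rightarrow> 'w::ab_group_add \<Rightarrow> 'w) \<Rightarrow> ('v \<times> 'v \<Rightarrow>\<^sub>0 'k) set \<Rightarrow> ('v \<Rightarrow> 'v \<Rightarrow> 'w) \<Rightarrow> 'w" where
  "sweedler s t f = free_eval s (\<lambda>(a, b). f a b) (tensor_rep t)"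

definition bilinear_map ::
    "('k::field \<Rightarrow> 'v::ab_group_add \<Rightarrow> 'v) \<Rightarrow> ('k \<Rightarrow> 'w::ab_group_add \<Rightarrow> 'w) \<Rightarrow> ('v \<Rightarrow> 'v \<Rightarrow> 'w) \<Rightarrow> bool" where
  "bilinear_map s s' f \<longleftrightarrow>
    (\<forall>x. Vector_Spaces.linear s s' (f x)) \<and> (\<forall>y. Vector_Spaces.linear s s' (\<lambda>x. f x y))"

lemma free_eval_superset:
  assumes "vector_space s" "finite A" "Poly_Mapping.keys p \<subseteq> A"
  shows "free_eval s f p = (\<Sum>k\<in>A. s (Poly_Mapping.lookup p k) (f k))"
proof -
  interpret vector_space s by fact
  show ?thesis
    unfolding free_eval_def using assms(2,3)
    by (intro sum.mono_neutral_left) (auto simp: in_keys_iff)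
qed

lemma linear_free_eval:
  assumes "vector_space s"
  shows "Vector_Spaces.linear free_scale s (free_eval s f)"
proof -
  interpret vector_space s by fact
  have add: "free_eval s f (p + q) = free_eval s f p + free_eval s f q" for p q
  proof -
    let ?A = "Poly_Mapping.keys p \<union> Poly_Mapping.keys q"
    have "Poly_Mapping.keys (p + q) \<subseteq> ?A" by (rule Poly_Mapping.keys_add)
    then show ?thesis
      using free_eval_superset[OF assms, of ?A _ f]
      by (simp add: lookup_add scale_left_distrib sum.distrib)
  qed
  have scale: "free_eval s f (free_scale c p) = s c (free_eval s f p)" for c p
  proof -
    have "Poly_Mapping.keys (free_scale c p) \<subseteq> Poly_Mapping.keys p"
      by (auto simp: in_keys_iff)
    then show ?thesis
      using free_eval_superset[OF assms, of "Poly_Mapping.keys p" _ f]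
      by (simp add: scale_sum_right)
  qed
  show ?thesis
    by unfold_locales (simp_all add: add scale)
qed

lemma free_eval_single:
  assumes "vector_space s"
  shows "free_eval s f (Poly_Mapping.single k c) = s c (f k)"
proof -
  interpret vector_space s by fact
  show ?thesis
    using free_eval_superset[OF assms, of "{k}" "Poly_Mapping.single k c" f] by simp
qed

lemma sweedler_class:
  assumes s: "vector_space s" and f: "bilinear_map sv s f"
  shows "sweedler s (tensor_class (bilinear_relations sv) p) f = free_eval s (\<lambda>(a, b). f a b) p"
proof -
  interpret vector_space s by fact
  interpret E: Vector_Spaces.linear free_scale s "free_eval s (\<lambda>(a, b). f a b)"
    by (rule linear_free_eval[OF s])
  have l: "Vector_Spaces.linear sv s (f x)" "Vector_Spaces.linear sv s (\<lambda>x. f x y)" for x y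
    using f by (auto simp: bilinear_map_def)
  have "f x (y + y') = f x y + f x y'" "f x (sv c y) = s c (f x y)"
    "f (x + x') y = f x y + f x' y" "f (sv c x) y = s c (f x y)" for x x' y y' c
    using l[THEN Vector_Spaces.linear.axioms(3)] by (auto simp: module_hom_def module_hom_axioms_def)
  then have "free_eval s (\<lambda>(a, b). f a b) r = 0" if "r \<in> bilinear_relations sv" for r
    using that by (auto simp: bilinear_relations_def E.diff free_eval_single[OF s])
  then have "free_eval s (\<lambda>(a, b). f a b) r = 0" if "r \<in> free.span (bilinear_relations sv)" for r
    using that E.eq_0_on_span by blast
  from this[OF tensor_rep_class] show ?thesis
    by (simp add: sweedler_def E.diff)
qed


section \<open>Leibniz algebras and coalgebras\<close>

locale leibniz_algebra = vector_space scale
  for scale :: "'k::field \<Rightarrow> 'v::ab_group_add \<Rightarrow> 'v" +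
  fixes bracket :: "'v \<Rightarrow> 'v \<Rightarrow> 'v"
  assumes bilinear_bracket: "bilinear_map scale scale bracket"
    and left_leibniz:
      "bracket x (bracket y z) = bracket (bracket x y) z + bracket y (bracket x z)"

text \<open>In the co-Leibniz identity both sides are equated in the threefold tensor product. The
  formal linear combinations of triples depend on the chosen representatives, but their classes
  do not.\<close>

locale leibniz_coalgebra = vector_space scale
  for scale :: "'k::field \<Rightarrow> 'v::ab_group_add \<Rightarrow> 'v" +
  fixes \<delta> :: "'v \<Rightarrow> ('v \<times> 'v \<Rightarrow>\<^sub>0 'k) set"
  assumes delta_in: "\<delta> x \<in> tensor_space (bilinear_relations scale)"
    and delta_add: "\<delta> (x + y) = tensor_add (bilinear_relations scale) (\<delta> x) (\<delta> y)"
    and delta_scale: "\<delta> (scale c x) = tensor_scale (bilinear_relations scale) c (\<delta> x)"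
    and co_leibniz:
      "tensor_class (trilinear_relations scale)
         (sweedler free_scale (\<delta> x) (\<lambda>x1 x2.
            sweedler free_scale (\<delta> x2) (\<lambda>x21 x22. Poly_Mapping.single (x1, x21, x22) 1))) =
       tensor_class (trilinear_relations scale)
         (sweedler free_scale (\<delta> x) (\<lambda>x1 x2.
            sweedler free_scale (\<delta> x1) (\<lambda>x11 x12. Poly_Mapping.single (x11, x12, x2) 1)) +
          sweedler free_scale (\<delta> x) (\<lambda>x1 x2.
            sweedler free_scale (\<delta> x2) (\<lambda>x21 x22. Poly_Mapping.single (x21, x1, x22) 1)))"

definition symmetric_bilinear_form ::
    "('k::field \<Rightarrow> 'v::ab_group_add \<Rightarrow> 'v) \<Rightarrow> ('v \<Rightarrow> 'v \<Rightarrow> 'k) \<Rightarrow> bool" where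
  "symmetric_bilinear_form scale \<omega> \<longleftrightarrow>
    bilinear_map scale (*) \<omega> \<and> (\<forall>x y. \<omega> x y = \<omega> y x)"

definition omega_bracket ::
    "('k::field \<Rightarrow> 'v::ab_group_add \<Rightarrow> 'v) \<Rightarrow> ('v \<Rightarrow> ('v \<times> 'v \<Rightarrow>\<^sub>0 'k) set) \<Rightarrow>
      ('v \<Rightarrow> 'v \<Rightarrow> 'k) \<Rightarrow> 'v \<Rightarrow> 'v \<Rightarrow> 'v" where
  "omega_bracket scale \<delta> \<omega> x y =
    - sweedler scale (\<delta> y) (\<lambda>y1 y2. scale (\<omega> x y1) y2)
    + sweedler scale (\<delta> x) (\<lambda>x1 x2. scale (\<omega> y x1) x2)
    + sweedler scale (\<delta> x) (\<lambda>x1 x2. scale (\<omega> y x2) x1)"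

text \<open>The bracket \<open>omega_bracket scale \<delta> \<omega>\<close> is determined by the other data, so it is not a
  parameter here.\<close>

locale dual_triangular_leibniz_bialgebra = leibniz_coalgebra scale \<delta>
  for scale :: "'k::field \<Rightarrow> 'v::ab_group_add \<Rightarrow> 'v"
    and \<delta> :: "'v \<Rightarrow> ('v \<times> 'v \<Rightarrow>\<^sub>0 'k) set" +
  fixes \<omega> :: "'v \<Rightarrow> 'v \<Rightarrow> 'k"
  assumes symmetric_form: "symmetric_bilinear_form scale \<omega>"
    and co_yang_baxter:
      "sweedler (*) (\<delta> y) (\<lambda>y1 y2. \<omega> x y1 * \<omega> y2 z) +
       sweedler (*) (\<delta> z) (\<lambda>z1 z2. \<omega> x z1 * \<omega> y z2) =
       sweedler (*) (\<delta> x) (\<lambda>x1 x2. \<omega> y x1 * \<omega> x2 z) +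
       sweedler (*) (\<delta> x) (\<lambda>x1 x2. \<omega> x1 z * \<omega> y x2)"

locale symplectic_leibniz_algebra = leibniz_algebra scale bracket
  for scale :: "'k::field \<Rightarrow> 'v::ab_group_add \<Rightarrow> 'v"
    and bracket :: "'v \<Rightarrow> 'v \<Rightarrow> 'v" +
  fixes \<omega> :: "'v \<Rightarrow> 'v \<Rightarrow> 'k"
  assumes symmetric_form: "symmetric_bilinear_form scale \<omega>"
    and symplectic:
      "\<omega> (bracket x y) z + \<omega> (bracket x z) y = \<omega> (bracket y z) x + \<omega> (bracket z y) x"

end

theory Submission
  imports Defs
begin

text \<open>For a linear functional \<open>f\<close> on the coalgebra write \<open>L\<^sub>f x = f(x\<^sub>1) x\<^sub>2\<close> and
  \<open>R\<^sub>f x = x\<^sub>1 f(x\<^sub>2)\<close>, and let \<open>f * g = (f \<otimes> g) \<circ> \<delta>\<close> be the product that \<open>\<delta>\<close> induces on the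
  dual space. With \<open>\<omega>\<^sub>x = \<omega>(x, -)\<close> the bracket is
  \<open>[x, y]\<^sub>\<omega> = - L\<^bsub>\<omega>\<^sub>x\<^esub> y + (L\<^bsub>\<omega>\<^sub>y\<^esub> + R\<^bsub>\<omega>\<^sub>y\<^esub>) x\<close>.

  Applying \<open>\<omega>(-, z)\<close> to this formula gives three terms, and the co-Yang-Baxter equation says
  precisely that they add up to \<open>(\<omega>\<^sub>x * \<omega>\<^sub>y)(z)\<close>; thus
  \<open>\<omega>([x, y]\<^sub>\<omega>, z) = (\<omega>\<^sub>x * \<omega>\<^sub>y)(z)\<close> (\<open>form_omega_bracket\<close>). In this form the symplectic
  condition is again the co-Yang-Baxter equation.

  For the Leibniz identity, which has to hold in the space itself even when \<open>\<omega>\<close> is degenerate,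
  contract two of the three tensor legs of the co-Leibniz identity with functionals. This gives
  \<open>L\<^sub>g L\<^sub>f = L\<^bsub>f*g\<^esub> + L\<^sub>f L\<^sub>g\<close>, \<open>R\<^sub>g L\<^sub>f = L\<^sub>f R\<^sub>g + R\<^bsub>f*g\<^esub>\<close> and
  \<open>R\<^bsub>f*g\<^esub> = R\<^sub>f R\<^sub>g + R\<^sub>g L\<^sub>f\<close>, the last two of which yield \<open>L\<^sub>f R\<^sub>g + R\<^sub>f R\<^sub>g = 0\<close>.
  The functional of \<open>[y, z]\<^sub>\<omega>\<close> being \<open>\<omega>\<^sub>y * \<omega>\<^sub>z\<close>, both sides of the Leibniz identity for
  \<open>x, y, z\<close> are sums of words in these operators applied to \<open>x\<close>, \<open>y\<close> and \<open>z\<close>, and the relations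
  above match the terms in each variable separately.\<close>

section \<open>Linear maps and Sweedler sums\<close>

lemma vector_space_field_mult: "vector_space ((*) :: 'k::field \<Rightarrow> 'k \<Rightarrow> 'k)"
  by unfold_locales (simp_all add: algebra_simps)

lemma linear_apply_scale: "Vector_Spaces.linear s s' h \<Longrightarrow> h (s c x) = s' c (h x)"
  by (simp add: Vector_Spaces.linear_iff)

lemma bilinear_map_iff:
  "bilinear_map s s' f \<longleftrightarrow> vector_space s \<and> vector_space s' \<and>
    (\<forall>x y z. f x (y + z) = f x y + f x z) \<and> (\<forall>c x y. f x (s c y) = s' c (f x y)) \<and>
    (\<forall>x y z. f (x + y) z = f x z + f y z) \<and> (\<forall>c x y. f (s c x) y = s' c (f x y))"
  unfolding bilinear_map_def Vector_Spaces.linear_iff by blast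

definition trilinear_map ::
    "('k::field \<Rightarrow> 'v::ab_group_add \<Rightarrow> 'v) \<Rightarrow> ('k \<Rightarrow> 'w::ab_group_add \<Rightarrow> 'w) \<Rightarrow>
      ('v \<Rightarrow> 'v \<Rightarrow> 'v \<Rightarrow> 'w) \<Rightarrow> bool" where
  "trilinear_map s s' t \<longleftrightarrow>
    (\<forall>y z. Vector_Spaces.linear s s' (\<lambda>x. t x y z)) \<and>
    (\<forall>x z. Vector_Spaces.linear s s' (\<lambda>y. t x y z)) \<and>
    (\<forall>x y. Vector_Spaces.linear s s' (t x y))"

text \<open>Both sides are finite sums over the same representative of \<open>t\<close>, hence \<open>h\<close> acts summand by
  summand.\<close>

lemma linear_sweedler:
  assumes "Vector_Spaces.linear s s' h"
  shows "h (sweedler s t F) = sweedler s' t (\<lambda>a b. h (F a b))"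
proof -
  interpret Vector_Spaces.linear s s' h by fact
  show ?thesis
    by (simp add: sweedler_def free_eval_def sum scale split_beta)
qed

lemma sweedler_plus:
  assumes "vector_space s"
  shows "sweedler s t (\<lambda>a b. F a b + G a b) = sweedler s t F + sweedler s t G"
proof -
  interpret vector_space s by fact
  show ?thesis
    by (simp add: sweedler_def free_eval_def split_beta scale_right_distrib sum.distrib)
qed

text \<open>A trilinear map kills the trilinear relations, so its extension to formal combinations
  descends to the threefold tensor product.\<close>

lemma free_eval_trilinear_eq:
  assumes t: "trilinear_map s s' t"
    and pq: "tensor_class (trilinear_relations s) p = tensor_class (trilinear_relations s) q"
  shows "free_eval s' (\<lambda>(a, b, c). t a b c) p = free_eval s' (\<lambda>(a, b, c). t a b c) q"
proof -
  have s': "vector_space s'"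
    using t by (auto simp: trilinear_map_def Vector_Spaces.linear_iff)
  interpret E: Vector_Spaces.linear free_scale s' "free_eval s' (\<lambda>(a, b, c). t a b c)"
    by (rule linear_free_eval[OF s'])
  interpret vector_space s' by (rule s')
  have "free_eval s' (\<lambda>(a, b, c). t a b c) r = 0" if "r \<in> trilinear_relations s" for r
    using that t
    by (auto simp: trilinear_relations_def trilinear_map_def Vector_Spaces.linear_iff
        E.diff free_eval_single[OF s'])
  moreover have "p - q \<in> free.span (trilinear_relations s)"
    using pq by (simp add: tensor_class_eq_iff)
  ultimately have "free_eval s' (\<lambda>(a, b, c). t a b c) (p - q) = 0"
    using E.eq_0_on_span by blast
  then show ?thesis by (simp add: E.diff)
qed

context leibniz_coalgebra
begin

lemma linear_sweedler_delta:
  assumes F: "bilinear_map scale s F"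
  shows "Vector_Spaces.linear scale s (\<lambda>x. sweedler s (\<delta> x) F)"
proof -
  have s: "vector_space s"
    using F by (simp add: bilinear_map_iff)
  interpret E: Vector_Spaces.linear free_scale s "free_eval s (\<lambda>(a, b). F a b)"
    by (rule linear_free_eval[OF s])
  have "sweedler s (\<delta> (x + y)) F = sweedler s (\<delta> x) F + sweedler s (\<delta> y) F" for x y
    by (simp only: delta_add tensor_add_def sweedler_class[OF s F] E.add) (simp add: sweedler_def)
  moreover have "sweedler s (\<delta> (scale c x)) F = s c (sweedler s (\<delta> x) F)" for c x
    by (simp only: delta_scale tensor_scale_def sweedler_class[OF s F] E.scale)
      (simp add: sweedler_def)
  ultimately show ?thesis
    using s vector_space_axioms by (simp add: Vector_Spaces.linear_iff)
qed

text \<open>The co-Leibniz identity is an equality of cosets; evaluating it turns it into equations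
  between iterated Sweedler sums in a vector space, one for every trilinear map.\<close>

lemma co_leibniz_trilinear:
  assumes t: "trilinear_map scale s t"
  shows "sweedler s (\<delta> x) (\<lambda>x1 x2. sweedler s (\<delta> x2) (\<lambda>x21 x22. t x1 x21 x22)) =
    sweedler s (\<delta> x) (\<lambda>x1 x2. sweedler s (\<delta> x1) (\<lambda>x11 x12. t x11 x12 x2)) +
    sweedler s (\<delta> x) (\<lambda>x1 x2. sweedler s (\<delta> x2) (\<lambda>x21 x22. t x21 x1 x22))"
proof -
  have s: "vector_space s"
    using t by (auto simp: trilinear_map_def Vector_Spaces.linear_iff)
  note E = linear_free_eval[OF s, of "\<lambda>(a, b, c). t a b c"]
  interpret E: Vector_Spaces.linear free_scale s "free_eval s (\<lambda>(a, b, c). t a b c)"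
    by (rule E)
  from free_eval_trilinear_eq[OF t co_leibniz[of x]] show ?thesis
    by (simp add: E.add linear_sweedler[OF E] free_eval_single[OF s]
        vector_space.vector_space_assms(4)[OF s])
qed


section \<open>Contracting the comultiplication with functionals\<close>

definition left_contraction :: "('v \<Rightarrow> 'k) \<Rightarrow> 'v \<Rightarrow> 'v" where
  "left_contraction f x = sweedler scale (\<delta> x) (\<lambda>x1 x2. scale (f x1) x2)"

definition right_contraction :: "('v \<Rightarrow> 'k) \<Rightarrow> 'v \<Rightarrow> 'v" where
  "right_contraction f x = sweedler scale (\<delta> x) (\<lambda>x1 x2. scale (f x2) x1)"

definition convolution :: "('v \<Rightarrow> 'k) \<Rightarrow> ('v \<Rightarrow> 'k) \<Rightarrow> 'v \<Rightarrow> 'k" where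
  "convolution f g x = sweedler (*) (\<delta> x) (\<lambda>x1 x2. f x1 * g x2)"

abbreviation functional :: "('v \<Rightarrow> 'k) \<Rightarrow> bool" where
  "functional \<equiv> Vector_Spaces.linear scale (*)"

lemma linear_scale_right: "Vector_Spaces.linear scale scale (scale c)"
  unfolding Vector_Spaces.linear_iff
  using vector_space_axioms by (simp add: scale_right_distrib mult.commute)

lemma linear_scale_left: "Vector_Spaces.linear (*) scale (\<lambda>c. scale c x)"
  unfolding Vector_Spaces.linear_iff
  using vector_space_axioms vector_space_field_mult by (auto simp: scale_left_distrib)

lemma linear_left_contraction:
  assumes "functional f"
  shows "Vector_Spaces.linear scale scale (left_contraction f)"
  unfolding left_contraction_def
  using assms vector_space_axioms
  by (intro linear_sweedler_delta)
    (auto simp: bilinear_map_iff Vector_Spaces.linear_iff scale_left_distrib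
      scale_right_distrib mult.commute)

lemma linear_right_contraction:
  assumes "functional f"
  shows "Vector_Spaces.linear scale scale (right_contraction f)"
  unfolding right_contraction_def
  using assms vector_space_axioms
  by (intro linear_sweedler_delta)
    (auto simp: bilinear_map_iff Vector_Spaces.linear_iff scale_left_distrib
      scale_right_distrib mult.commute)

lemma trilinear_two_functionals:
  assumes "functional f" "functional g"
  shows "trilinear_map scale scale (\<lambda>a b c. scale (f a * g b) c)"
    and "trilinear_map scale scale (\<lambda>a b c. scale (f a * g c) b)"
    and "trilinear_map scale scale (\<lambda>a b c. scale (f b * g c) a)"
  using assms vector_space_axioms
  by (auto simp: trilinear_map_def Vector_Spaces.linear_iff scale_left_distrib
      scale_right_distrib algebra_simps)

lemma linear_of_left_contraction:
  assumes h: "Vector_Spaces.linear scale s h"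
  shows "h (left_contraction f x) = sweedler s (\<delta> x) (\<lambda>x1 x2. s (f x1) (h x2))"
  by (simp add: left_contraction_def linear_sweedler[OF h] linear_apply_scale[OF h])

lemma linear_of_right_contraction:
  assumes h: "Vector_Spaces.linear scale s h"
  shows "h (right_contraction f x) = sweedler s (\<delta> x) (\<lambda>x1 x2. s (f x2) (h x1))"
  by (simp add: right_contraction_def linear_sweedler[OF h] linear_apply_scale[OF h])

lemma scale_contraction:
  "scale c (left_contraction f x) = sweedler scale (\<delta> x) (\<lambda>x1 x2. scale (c * f x1) x2)"
  "scale c (right_contraction f x) = sweedler scale (\<delta> x) (\<lambda>x1 x2. scale (c * f x2) x1)"
  by (simp_all add: linear_of_left_contraction[OF linear_scale_right]
      linear_of_right_contraction[OF linear_scale_right] mult.commute)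

lemma contraction_convolution:
  "left_contraction (convolution f g) x =
    sweedler scale (\<delta> x) (\<lambda>x1 x2. sweedler scale (\<delta> x1) (\<lambda>x11 x12. scale (f x11 * g x12) x2))"
  "right_contraction (convolution f g) x =
    sweedler scale (\<delta> x) (\<lambda>x1 x2. sweedler scale (\<delta> x2) (\<lambda>x21 x22. scale (f x21 * g x22) x1))"
  unfolding left_contraction_def right_contraction_def convolution_def
    linear_sweedler[OF linear_scale_left] by (rule refl)+

text \<open>The three relations below are the co-Leibniz identity with the third, the second and the
  first tensor leg left open.\<close>

lemma left_contraction_left_contraction:
  assumes f: "functional f" and g: "functional g"
  shows "left_contraction g (left_contraction f x) =
    left_contraction (convolution f g) x + left_contraction f (left_contraction g x)"
  using co_leibniz_trilinear[OF trilinear_two_functionals(1)[OF f g], of x]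
  by (simp add: linear_of_left_contraction[OF linear_left_contraction] f g
      scale_contraction contraction_convolution mult.commute)

lemma right_contraction_left_contraction:
  assumes f: "functional f" and g: "functional g"
  shows "right_contraction g (left_contraction f x) =
    left_contraction f (right_contraction g x) + right_contraction (convolution f g) x"
  using co_leibniz_trilinear[OF trilinear_two_functionals(2)[OF f g], of x]
  by (simp add: linear_of_left_contraction[OF linear_right_contraction]
      linear_of_right_contraction[OF linear_left_contraction] f g
      scale_contraction contraction_convolution mult.commute)

lemma right_contraction_convolution:
  assumes f: "functional f" and g: "functional g"
  shows "right_contraction (convolution f g) x =
    right_contraction f (right_contraction g x) + right_contraction g (left_contraction f x)"
  using co_leibniz_trilinear[OF trilinear_two_functionals(3)[OF f g], of x]
  by (simp add: linear_of_left_contraction[OF linear_right_contraction]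
      linear_of_right_contraction[OF linear_right_contraction] f g
      scale_contraction contraction_convolution mult.commute)

text \<open>Eliminate \<open>R\<^bsub>f*g\<^esub>\<close> from the last two relations: \<open>R\<^sub>g L\<^sub>f\<close> drops out as well.\<close>

lemma contraction_right_contraction_cancel:
  assumes "functional f" "functional g"
  shows "left_contraction f (right_contraction g x) + right_contraction f (right_contraction g x) = 0"
  using right_contraction_left_contraction[OF assms, of x]
    right_contraction_convolution[OF assms, of x]
  by (simp add: algebra_simps)

lemma contraction_functional_plus:
  "left_contraction (\<lambda>a. f a + g a) x = left_contraction f x + left_contraction g x"
  "right_contraction (\<lambda>a. f a + g a) x = right_contraction f x + right_contraction g x"
  by (simp_all add: left_contraction_def right_contraction_def scale_left_distrib
      sweedler_plus[OF vector_space_axioms])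

lemma contraction_functional_scale:
  "left_contraction (\<lambda>a. c * f a) x = scale c (left_contraction f x)"
  "right_contraction (\<lambda>a. c * f a) x = scale c (right_contraction f x)"
  by (simp_all add: left_contraction_def right_contraction_def
      linear_sweedler[OF linear_scale_right])

end


section \<open>The bracket of a dual triangular Leibniz bialgebra\<close>

context dual_triangular_leibniz_bialgebra
begin

lemma functional_form: "functional (\<omega> x)"
  using symmetric_form by (simp add: symmetric_bilinear_form_def bilinear_map_def)

lemma form_commute: "\<omega> x y = \<omega> y x"
  using symmetric_form by (simp add: symmetric_bilinear_form_def)

lemma form_plus: "\<omega> (x + y) = (\<lambda>a. \<omega> x a + \<omega> y a)"
  and form_scale: "\<omega> (scale c x) = (\<lambda>a. c * \<omega> x a)"
  using symmetric_form by (auto simp: symmetric_bilinear_form_def bilinear_map_iff)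

lemma omega_bracket_contraction:
  "omega_bracket scale \<delta> \<omega> x y =
    - left_contraction (\<omega> x) y + left_contraction (\<omega> y) x + right_contraction (\<omega> y) x"
  by (simp add: omega_bracket_def left_contraction_def right_contraction_def)

lemma co_yang_baxter_convolution:
  "convolution (\<omega> x) (\<omega> z) y + convolution (\<omega> x) (\<omega> y) z =
    convolution (\<omega> y) (\<omega> z) x + convolution (\<omega> z) (\<omega> y) x"
  using co_yang_baxter[of y x z]
  by (simp add: convolution_def form_commute[of _ z])

lemma form_contraction:
  "\<omega> z (left_contraction (\<omega> x) y) = convolution (\<omega> x) (\<omega> z) y"
  "\<omega> z (right_contraction (\<omega> x) y) = convolution (\<omega> z) (\<omega> x) y"
  by (simp_all add: linear_of_left_contraction[OF functional_form]
      linear_of_right_contraction[OF functional_form] convolution_def mult.commute)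

text \<open>Pairing the bracket with \<open>z\<close> produces three of the four terms of the co-Yang-Baxter
  equation, so only the fourth one remains.\<close>

lemma form_omega_bracket:
  "\<omega> (omega_bracket scale \<delta> \<omega> x y) = convolution (\<omega> x) (\<omega> y)"
proof
  fix z
  interpret z: Vector_Spaces.linear scale "(*)" "\<omega> z" by (rule functional_form)
  have "\<omega> (omega_bracket scale \<delta> \<omega> x y) z =
      - convolution (\<omega> x) (\<omega> z) y + convolution (\<omega> y) (\<omega> z) x + convolution (\<omega> z) (\<omega> y) x"
    by (simp add: form_commute[of _ z] omega_bracket_contraction z.add z.neg z.diff form_contraction)
  also have "\<dots> = convolution (\<omega> x) (\<omega> y) z"
    using co_yang_baxter_convolution[of x z y] by (simp add: algebra_simps)
  finally show "\<omega> (omega_bracket scale \<delta> \<omega> x y) z = convolution (\<omega> x) (\<omega> y) z" .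
qed

lemma bilinear_omega_bracket: "bilinear_map scale scale (omega_bracket scale \<delta> \<omega>)"
proof -
  have L: "Vector_Spaces.linear scale scale (left_contraction (\<omega> x))"
    and R: "Vector_Spaces.linear scale scale (right_contraction (\<omega> x))" for x
    by (simp_all add: linear_left_contraction linear_right_contraction functional_form)
  show ?thesis
    using L R unfolding bilinear_map_iff Vector_Spaces.linear_iff
    by (simp add: omega_bracket_contraction form_plus form_scale contraction_functional_plus
        contraction_functional_scale scale_right_distrib scale_right_diff_distrib algebra_simps)
qed

text \<open>Expand both sides, using that \<open>[a, b]\<^sub>\<omega>\<close> has the functional \<open>\<omega>\<^sub>a * \<omega>\<^sub>b\<close>. The terms applied to
  \<open>z\<close> agree by \<open>L\<^bsub>f*g\<^esub> = L\<^sub>g L\<^sub>f - L\<^sub>f L\<^sub>g\<close>, and those applied to \<open>y\<close> by this and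
  \<open>R\<^bsub>f*g\<^esub> = R\<^sub>g L\<^sub>f - L\<^sub>f R\<^sub>g\<close>. After the same two substitutions the terms applied to \<open>x\<close> leave
  just \<open>L\<^sub>f R\<^sub>g x + R\<^sub>f R\<^sub>g x = 0\<close> with \<open>f = \<omega>\<^sub>z\<close> and \<open>g = \<omega>\<^sub>y\<close>.\<close>

lemma left_leibniz_omega_bracket:
  fixes x y z
  defines "B \<equiv> omega_bracket scale \<delta> \<omega>"
  shows "B x (B y z) = B (B x y) z + B y (B x z)"
proof -
  have expand: "B a b = - left_contraction (\<omega> a) b + left_contraction (\<omega> b) a
      + right_contraction (\<omega> b) a" for a b
    by (simp add: B_def omega_bracket_contraction)
  have form: "\<omega> (B a b) = convolution (\<omega> a) (\<omega> b)" for a b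
    by (simp add: B_def form_omega_bracket)
  define L R where "L a = left_contraction (\<omega> a)" and "R a = right_contraction (\<omega> a)" for a
  define L2 R2 where "L2 a b = left_contraction (convolution (\<omega> a) (\<omega> b))"
    and "R2 a b = right_contraction (convolution (\<omega> a) (\<omega> b))" for a b
  have B: "B a b = - L a b + L b a + R b a" for a b
    by (simp add: expand L_def R_def)
  \<comment> \<open>The outer bracket is expanded while the inner one still stands as an argument of \<open>\<omega>\<close>,
    where it becomes a convolution.\<close>
  have B_right: "B a (B b c) = - L a (B b c) + L2 b c a + R2 b c a" for a b c
    by (simp add: expand[of a "B b c"] form L_def L2_def R2_def)
  have B_left: "B (B a b) c = - L2 a b c + L c (B a b) + R c (B a b)" for a b c
    by (simp add: expand[of "B a b" c] form L_def R_def L2_def)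
  interpret L: Vector_Spaces.linear scale scale "L a" for a
    unfolding L_def by (rule linear_left_contraction[OF functional_form])
  interpret R: Vector_Spaces.linear scale scale "R a" for a
    unfolding R_def by (rule linear_right_contraction[OF functional_form])
  have LL: "L2 a b c = L b (L a c) - L a (L b c)"
    and RL: "R2 a b c = R b (L a c) - L a (R b c)"
    and cancel: "R a (R b c) = - L a (R b c)" for a b c
    using left_contraction_left_contraction[OF functional_form functional_form, of b a c]
      right_contraction_left_contraction[OF functional_form functional_form, of b a c]
      contraction_right_contraction_cancel[OF functional_form functional_form, of a b c]
    by (simp_all add: L_def R_def L2_def R2_def eq_neg_iff_add_eq_0 add.commute)
  show ?thesis
    unfolding B_right B_left
    unfolding B
    by (simp add: L.add L.neg L.diff R.add R.neg R.diff LL RL cancel)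
qed

end

theorem proposition3p9:
  fixes scale :: "'k::field \<Rightarrow> 'v::ab_group_add \<Rightarrow> 'v"
    and \<delta> :: "'v \<Rightarrow> ('v \<times> 'v \<Rightarrow>\<^sub>0 'k) set"
    and \<omega> :: "'v \<Rightarrow> 'v \<Rightarrow> 'k"
  assumes "leibniz_coalgebra scale \<delta>"
    and "symmetric_bilinear_form scale \<omega>"
    and "dual_triangular_leibniz_bialgebra scale \<delta> \<omega>"
  shows "symplectic_leibniz_algebra scale (omega_bracket scale \<delta> \<omega>) \<omega>"
proof -
  interpret dual_triangular_leibniz_bialgebra scale \<delta> \<omega> by fact
  show ?thesis
  proof
    show "bilinear_map scale scale (omega_bracket scale \<delta> \<omega>)"
      by (rule bilinear_omega_bracket)
    show "omega_bracket scale \<delta> \<omega> x (omega_bracket scale \<delta> \<omega> y z) =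
        omega_bracket scale \<delta> \<omega> (omega_bracket scale \<delta> \<omega> x y) z +
        omega_bracket scale \<delta> \<omega> y (omega_bracket scale \<delta> \<omega> x z)" for x y z
      by (rule left_leibniz_omega_bracket)
    show "symmetric_bilinear_form scale \<omega>" by fact
    show "\<omega> (omega_bracket scale \<delta> \<omega> x y) z + \<omega> (omega_bracket scale \<delta> \<omega> x z) y =
        \<omega> (omega_bracket scale \<delta> \<omega> y z) x + \<omega> (omega_bracket scale \<delta> \<omega> z y) x" for x y z
      using co_yang_baxter_convolution[of x y z] by (simp add: form_omega_bracket add.commute)
  qed
qed

end
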